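(* Let $U$ be a unitary operator on a separable complex Hilbert space $\mathcal{H}$ such that $1$ is an accumulation point of its spectrum $\sigma(U)$, let $L:=UP^U(\partial\mathbb{D}\setminus\{1\})$, and suppose that $L^j$ converges to zero in the weak operator topology as $j\to\infty$. Let $\mathcal{G}(U)$ be the set of all $\psi\in\mathcal{H}$ such that, for all $\epsilon>0$, $$\limsup_{K\to\infty}K^{\epsilon}\,\Big\|\frac1K\sum_{j=0}^{K-1}U^j\psi-\psi^*\Big\|^2=\infty\quad\text{and}\quad\liminf_{K\to\infty}K^{2-\epsilon}\,\Big\|\frac1K\sum_{j=0}^{K-1}U^j\psi-\psi^*\Big\|^2=0.$$ If $\psi\in\mathcal{G}(U)$, then $$0=d^-_{\mu^U_{\psi-\psi^*}}(1)<2\le d^+_{\mu^U_{\psi-\psi^*}}(1).$$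
   Context: Write $\partial\mathbb{D}=\{z\in\mathbb{C}: |z|=1\}$. $P^U$ denotes the resolution of the identity (projection-valued spectral measure on $\partial\mathbb{D}$) of $U$, and $\psi^*:=P^U(\{1\})\psi$, i.e. the orthogonal projection of $\psi$ onto $\{\varphi\in\mathcal{H}: U\varphi=\varphi\}$. Convergence of $L^j$ to zero in the weak operator topology means $\langle L^j\psi,\varphi\rangle\to0$ as $j\to\infty$ for all $\psi,\varphi\in\mathcal{H}$. $K$ ranges over the positive integers. For $\varphi\in\mathcal{H}$, $\mu^U_\varphi$ is the spectral measure of $U$ with respect to $\varphi$, i.e. the finite positive Borel measure on $\partial\mathbb{D}$ given by $\mu^U_\varphi(\Lambda)=\|P^U(\Lambda)\varphi\|^2$. For $0<\epsilon\le\pi$ put $A_\epsilon:=\{e^{i\theta}: -\epsilon<\theta\le\epsilon\}$. For a finite positive Borel measure $\mu$ on $\partial\mathbb{D}$, the lower and upper pointwise exponents at $z=1$ are $$d^-_\mu(1):=\liminf_{\epsilon\downarrow0}\frac{\ln\mu(A_\epsilon)}{\ln\epsilon},\qquad d^+_\mu(1):=\limsup_{\epsilon\downarrow0}\frac{\ln\mu(A_\epsilon)}{\ln\epsilon}$$ if $\mu(A_\epsilon)>0$ for all small enough $\epsilon>0$, and $d^\mp_\mu(1):=\infty$ otherwise. *)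

theory Defs
  imports "HOL-Analysis.Analysis"
begin

section \<open>Complex Hilbert spaces\<close>

text \<open>The inner product is linear in the first and conjugate-linear in the second argument.\<close>

class complex_inner = real_normed_vector +
  fixes scaleC :: "complex \<Rightarrow> 'a \<Rightarrow> 'a"  (infixr "*\<^sub>C" 75)
    and cinner :: "'a \<Rightarrow> 'a \<Rightarrow> complex"
  assumes scaleC_add_right: "c *\<^sub>C (x + y) = c *\<^sub>C x + c *\<^sub>C y"
    and scaleC_add_left: "(c + d) *\<^sub>C x = c *\<^sub>C x + d *\<^sub>C x"
    and scaleC_scaleC: "c *\<^sub>C d *\<^sub>C x = (c * d) *\<^sub>C x"
    and scaleC_of_real: "complex_of_real r *\<^sub>C x = r *\<^sub>R x"
    and cinner_add_left: "cinner (x + y) z = cinner x z + cinner y z"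
    and cinner_scaleC_left: "cinner (c *\<^sub>C x) y = c * cinner x y"
    and cinner_commute: "cinner y x = cnj (cinner x y)"
    and cinner_self: "cinner x x = complex_of_real ((norm x)\<^sup>2)"

class complex_hilbert_space = complex_inner + complete_space

lemma cinner_add_right: "cinner x (y + z) = cinner x y + cinner x z"
  for x y z :: "'a::complex_inner"
  by (metis cinner_add_left cinner_commute complex_cnj_add)

lemma cinner_zero_left [simp]: "cinner 0 x = 0" for x :: "'a::complex_inner"
  using cinner_add_left [of 0 0 x] by simp

lemma cinner_sum_left: "cinner (sum f I) x = (\<Sum>i\<in>I. cinner (f i) x)"
  for x :: "'a::complex_inner"
  by (induction I rule: infinite_finite_induct) (auto simp: cinner_add_left)


section \<open>Operators\<close>

definition bounded_clinear :: "('a::complex_inner \<Rightarrow> 'a) \<Rightarrow> bool" where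
  "bounded_clinear T \<longleftrightarrow> bounded_linear T \<and> (\<forall>c x. T (c *\<^sub>C x) = c *\<^sub>C T x)"

definition unitary_op :: "('a::complex_inner \<Rightarrow> 'a) \<Rightarrow> bool" where
  "unitary_op U \<longleftrightarrow>
     bounded_clinear U \<and> surj U \<and> (\<forall>x y. cinner (U x) (U y) = cinner x y)"

definition op_spectrum :: "('a::complex_inner \<Rightarrow> 'a) \<Rightarrow> complex set" where
  "op_spectrum T =
     {z. \<not> (\<exists>R. bounded_clinear R \<and>
               (\<forall>x. R (T x - z *\<^sub>C x) = x) \<and> (\<forall>x. T (R x) - z *\<^sub>C R x = x))}"

definition orthogonal_projection :: "('a::complex_inner \<Rightarrow> 'a) \<Rightarrow> bool" where
  "orthogonal_projection E \<longleftrightarrow>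
     bounded_clinear E \<and> (\<forall>x. E (E x) = E x) \<and> (\<forall>x y. cinner (E x) y = cinner x (E y))"

definition wot_tendsto_zero :: "(nat \<Rightarrow> 'a::complex_inner \<Rightarrow> 'a) \<Rightarrow> bool" where
  "wot_tendsto_zero T \<longleftrightarrow> (\<forall>x y. (\<lambda>j. cinner (T j x) y) \<longlonglongrightarrow> 0)"


section \<open>Resolutions of the identity on the unit circle\<close>

definition circle_borel :: "complex measure" where
  "circle_borel = restrict_space borel (sphere 0 1)"

text \<open>Values of \<open>P\<close> outside the Borel subsets of the circle are irrelevant.\<close>

definition resolution_of_identity :: "(complex set \<Rightarrow> 'a::complex_inner \<Rightarrow> 'a) \<Rightarrow> bool" where
  "resolution_of_identity P \<longleftrightarrow>
     (\<forall>A\<in>sets circle_borel. orthogonal_projection (P A)) \<and>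
     (\<forall>x. P {} x = 0) \<and>
     (\<forall>x. P (sphere 0 1) x = x) \<and>
     (\<forall>A\<in>sets circle_borel. \<forall>B\<in>sets circle_borel. \<forall>x. P (A \<inter> B) x = P A (P B x)) \<and>
     (\<forall>A. range A \<subseteq> sets circle_borel \<longrightarrow> disjoint_family A \<longrightarrow>
        (\<forall>x. (\<lambda>n::nat. P (A n) x) sums P (\<Union>n. A n) x))"

definition spectral_measure ::
    "(complex set \<Rightarrow> 'a::complex_inner \<Rightarrow> 'a) \<Rightarrow> 'a \<Rightarrow> complex measure" where
  "spectral_measure P x =
     measure_of (sphere 0 1) (sets circle_borel) (\<lambda>A. ennreal ((norm (P A x))\<^sup>2))"

lemma space_circle_borel [simp]: "space circle_borel = sphere 0 1"
  by (simp add: circle_borel_def space_restrict_space)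

lemma sets_spectral_measure [simp]: "sets (spectral_measure P x) = sets circle_borel"
  unfolding spectral_measure_def
  by (metis sets.sets_measure_of_eq space_circle_borel)

lemma emeasure_spectral_measure:
  assumes P: "resolution_of_identity P" and A: "A \<in> sets circle_borel"
  shows "emeasure (spectral_measure P x) A = ennreal ((norm (P A x))\<^sup>2)"
proof -
  have orth: "cinner (P B x) (P C x) = 0"
    if B: "B \<in> sets circle_borel" and C: "C \<in> sets circle_borel" and "B \<inter> C = {}" for B C
  proof -
    have "cinner (P B x) (P C x) = cinner (P C (P B x)) x"
      using P C unfolding resolution_of_identity_def orthogonal_projection_def by metis
    also have "P C (P B x) = P (C \<inter> B) x"
      using P B C unfolding resolution_of_identity_def by metis
    also have "\<dots> = 0"
      using P that(3) unfolding resolution_of_identity_def by (metis Int_commute)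
    finally show ?thesis by simp
  qed
  have "countably_additive (sets circle_borel) (\<lambda>A. ennreal ((norm (P A x))\<^sup>2))"
  proof (rule countably_additiveI)
    fix B :: "nat \<Rightarrow> complex set"
    assume B: "range B \<subseteq> sets circle_borel" "disjoint_family B"
    have "(\<lambda>n. P (B n) x) sums P (\<Union>n. B n) x"
      using P B unfolding resolution_of_identity_def by blast
    then have "(\<lambda>n. (norm (\<Sum>i<n. P (B i) x))\<^sup>2) \<longlonglongrightarrow> (norm (P (\<Union>n. B n) x))\<^sup>2"
      unfolding sums_def by (intro tendsto_intros)
    moreover have "(norm (\<Sum>i<n. P (B i) x))\<^sup>2 = (\<Sum>i<n. (norm (P (B i) x))\<^sup>2)" for n
    proof (induction n)
      case (Suc n)
      let ?s = "\<Sum>i<n. P (B i) x"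
      have "cinner (P (B i) x) (P (B n) x) = 0" if "i < n" for i
        using that B by (intro orth) (auto simp: disjoint_family_on_def)
      then have 0: "cinner ?s (P (B n) x) = 0"
        by (simp add: cinner_sum_left)
      then have 1: "cinner (P (B n) x) ?s = 0"
        by (metis cinner_commute complex_cnj_zero)
      have "complex_of_real ((norm (?s + P (B n) x))\<^sup>2)
          = complex_of_real ((norm ?s)\<^sup>2 + (norm (P (B n) x))\<^sup>2)"
        unfolding cinner_self [symmetric] of_real_add cinner_add_left cinner_add_right 0 1
        by simp
      with Suc.IH show ?case
        by (simp only: of_real_eq_iff sum.lessThan_Suc)
    qed simp
    ultimately have "(\<lambda>n. (norm (P (B n) x))\<^sup>2) sums (norm (P (\<Union>n. B n) x))\<^sup>2"
      by (simp add: sums_def)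
    then show "(\<Sum>n. ennreal ((norm (P (B n) x))\<^sup>2)) = ennreal ((norm (P (\<Union>n. B n) x))\<^sup>2)"
      by (intro suminf_ennreal_eq) auto
  qed
  moreover have "positive (sets circle_borel) (\<lambda>A. ennreal ((norm (P A x))\<^sup>2))"
    using P by (simp add: positive_def resolution_of_identity_def)
  ultimately show ?thesis
    unfolding spectral_measure_def space_circle_borel [symmetric]
    by (intro emeasure_measure_of_sigma sets.sigma_algebra_axioms A)
qed

text \<open>
  \<open>U = \<integral> z dP(z)\<close>. The integral of a bounded Borel function \<open>f\<close> against \<open>P\<close> is the
  bounded operator \<open>T\<close> with \<open>\<langle>T x, x\<rangle> = \<integral> f d\<mu>\<^sub>x\<close> for all \<open>x\<close>, where
  \<open>\<mu>\<^sub>x(A) = \<parallel>P(A) x\<parallel>\<^sup>2 = \<langle>P(A) x, x\<rangle>\<close>; over the complex scalars the diagonal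
  determines \<open>T\<close>.
\<close>

definition resolution_of_identity_of ::
    "('a::complex_inner \<Rightarrow> 'a) \<Rightarrow> (complex set \<Rightarrow> 'a \<Rightarrow> 'a) \<Rightarrow> bool" where
  "resolution_of_identity_of U P \<longleftrightarrow>
     resolution_of_identity P \<and>
     (\<forall>x. cinner (U x) x = (LINT z|spectral_measure P x. z))"


section \<open>Pointwise exponents at 1\<close>

definition circle_arc :: "real \<Rightarrow> complex set" where
  "circle_arc \<epsilon> = {cis \<theta> | \<theta>. - \<epsilon> < \<theta> \<and> \<theta> \<le> \<epsilon>}"

definition lower_exponent_at_1 :: "complex measure \<Rightarrow> ereal" where
  "lower_exponent_at_1 \<mu> =
     (if \<forall>\<^sub>F \<epsilon> in at_right 0. measure \<mu> (circle_arc \<epsilon>) > 0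
      then Liminf (at_right 0) (\<lambda>\<epsilon>. ereal (ln (measure \<mu> (circle_arc \<epsilon>)) / ln \<epsilon>))
      else \<infinity>)"

definition upper_exponent_at_1 :: "complex measure \<Rightarrow> ereal" where
  "upper_exponent_at_1 \<mu> =
     (if \<forall>\<^sub>F \<epsilon> in at_right 0. measure \<mu> (circle_arc \<epsilon>) > 0
      then Limsup (at_right 0) (\<lambda>\<epsilon>. ereal (ln (measure \<mu> (circle_arc \<epsilon>)) / ln \<epsilon>))
      else \<infinity>)"


section \<open>Ergodic averages\<close>

definition ergodic_deviation ::
    "('a::complex_inner \<Rightarrow> 'a) \<Rightarrow> (complex set \<Rightarrow> 'a \<Rightarrow> 'a) \<Rightarrow> 'a \<Rightarrow> nat \<Rightarrow> real" where
  "ergodic_deviation U P \<psi> K =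
     norm ((1 / real K) *\<^sub>R (\<Sum>j<K. (U ^^ j) \<psi>) - P {1} \<psi>)"

definition G_set :: "('a::complex_inner \<Rightarrow> 'a) \<Rightarrow> (complex set \<Rightarrow> 'a \<Rightarrow> 'a) \<Rightarrow> 'a set" where
  "G_set U P =
     {\<psi>. \<forall>\<epsilon>>0.
        limsup (\<lambda>K. ereal (real K powr \<epsilon> * (ergodic_deviation U P \<psi> K)\<^sup>2)) = \<infinity> \<and>
        liminf (\<lambda>K. ereal (real K powr (2 - \<epsilon>) * (ergodic_deviation U P \<psi> K)\<^sup>2)) = 0}"

end

theory Submission
  imports Defs
begin

text \<open>
  Let \<open>\<mu>\<close> be the spectral measure of \<open>\<phi> = \<psi> - P {1} \<psi>\<close>. The squared deviation is
  \<open>D K = \<parallel>(1/K) \<Sum>\<^sub>j\<^sub><\<^sub>K U\<^sup>j \<phi>\<parallel>\<^sup>2 = K\<^sup>-\<^sup>2 \<integral> \<bar>\<Sum>\<^sub>j\<^sub><\<^sub>K z\<^sup>j\<bar>\<^sup>2 d\<mu>\<close>. The geometric sum is at least \<open>K/2\<close> on the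
  arc of half-width \<open>1/K\<close>, at most \<open>K\<close> everywhere and at most \<open>4/\<delta>\<close> off the arc of half-width \<open>\<delta>\<close>, so
  \<open>\<mu>(A\<^sub>1\<^sub>/\<^sub>K)/4 \<le> D K \<le> \<mu>(A\<^sub>\<delta>) + 16 \<parallel>\<phi>\<parallel>\<^sup>2 / (\<delta> K)\<^sup>2\<close>. The first inequality makes the fast
  subsequential decay of \<open>D\<close> force \<open>d\<^sup>+ \<ge> 2\<close>. With \<open>\<delta> = K\<^sup>-\<^sup>1\<^sup>/\<^sup>2\<close> the second one turns a positive
  \<open>d\<^sup>-\<close>, or a vanishing arc, into a polynomial rate for \<open>D\<close>; the loss of a factor 2 in the
  exponent is harmless because no rate at all is allowed.

  The integral formula is obtained by approximating \<open>U\<close> in operator norm by finite sums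
  \<open>\<Sum>\<^sub>c c P(A\<^sub>c)\<close>, whose powers are explicit.
\<close>

section \<open>Complex inner product spaces\<close>

lemma scaleC_zero_right [simp]: "c *\<^sub>C (0 :: 'a::complex_inner) = 0"
  using scaleC_add_right [of c "0::'a" 0] by simp

lemma scaleC_zero_left [simp]: "0 *\<^sub>C x = 0" for x :: "'a::complex_inner"
  using scaleC_of_real [of 0 x] by simp

lemma scaleC_minus_one: "(- 1) *\<^sub>C x = - x" for x :: "'a::complex_inner"
  using scaleC_of_real [of "- 1" x] by simp

lemma scaleC_diff_right: "c *\<^sub>C (x - y) = c *\<^sub>C x - c *\<^sub>C y" for x y :: "'a::complex_inner"
  using scaleC_add_right [of c "x - y" y] by simp

lemma scaleC_sum_right: "c *\<^sub>C sum f I = (\<Sum>i\<in>I. c *\<^sub>C f i)" for f :: "_ \<Rightarrow> 'a::complex_inner"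
  by (induction I rule: infinite_finite_induct) (auto simp: scaleC_add_right)

lemma scaleC_sum_left: "sum f I *\<^sub>C x = (\<Sum>i\<in>I. f i *\<^sub>C x)" for x :: "'a::complex_inner"
  by (induction I rule: infinite_finite_induct) (auto simp: scaleC_add_left)

lemma cinner_scaleC_right: "cinner x (c *\<^sub>C y) = cnj c * cinner x y" for x y :: "'a::complex_inner"
  by (metis cinner_commute cinner_scaleC_left complex_cnj_mult)

lemma cinner_diff_left: "cinner (x - y) z = cinner x z - cinner y z" for x y z :: "'a::complex_inner"
  using cinner_add_left [of "x - y" y z] by simp

lemma cinner_diff_right: "cinner x (y - z) = cinner x y - cinner x z" for x y z :: "'a::complex_inner"
  using cinner_add_right [of x "y - z" z] by simp

lemma norm_scaleC [simp]: "norm (c *\<^sub>C x) = cmod c * norm x" for x :: "'a::complex_inner"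
proof -
  have "complex_of_real ((norm (c *\<^sub>C x))\<^sup>2) = (c * cnj c) * complex_of_real ((norm x)\<^sup>2)"
    unfolding cinner_self [symmetric] by (simp add: cinner_scaleC_left cinner_scaleC_right)
  also have "\<dots> = complex_of_real ((cmod c * norm x)\<^sup>2)"
    by (simp add: complex_norm_square [symmetric] power_mult_distrib)
  finally have "(norm (c *\<^sub>C x))\<^sup>2 = (cmod c * norm x)\<^sup>2"
    by (simp only: of_real_eq_iff)
  then show ?thesis
    by (simp add: power2_eq_iff_nonneg)
qed

lemma norm_diff_square:
  "(norm (x - y))\<^sup>2 = (norm x)\<^sup>2 + (norm y)\<^sup>2 - 2 * Re (cinner x y)" for x y :: "'a::complex_inner"
proof -
  have "(norm (x - y))\<^sup>2 = Re (cinner (x - y) (x - y))"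
    by (simp add: cinner_self del: of_real_power)
  also have "\<dots> = Re (cinner x x) + Re (cinner y y) - Re (cinner x y) - Re (cinner y x)"
    by (simp add: cinner_diff_left cinner_diff_right)
  also have "Re (cinner y x) = Re (cinner x y)"
    by (subst cinner_commute) simp
  finally show ?thesis
    by (simp add: cinner_self del: of_real_power)
qed

lemma norm_sum_orthogonal:
  fixes f :: "'i \<Rightarrow> 'a::complex_inner"
  assumes "finite I" and "\<And>i j. i \<in> I \<Longrightarrow> j \<in> I \<Longrightarrow> i \<noteq> j \<Longrightarrow> cinner (f i) (f j) = 0"
  shows "(norm (\<Sum>i\<in>I. f i))\<^sup>2 = (\<Sum>i\<in>I. (norm (f i))\<^sup>2)"
  using assms
proof (induction I rule: finite_induct)
  case (insert a I)
  then have "cinner (\<Sum>i\<in>I. f i) (f a) = 0"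
    unfolding cinner_sum_left by (intro sum.neutral) auto
  \<comment> \<open>Written as a difference so that \<open>norm_diff_square\<close> supplies the
    Pythagorean step.\<close>
  moreover have "norm (f a + (\<Sum>i\<in>I. f i)) = norm ((\<Sum>i\<in>I. f i) - (-1) *\<^sub>C f a)"
    by (simp add: scaleC_minus_one add.commute)
  ultimately show ?case
    using insert by (simp add: norm_diff_square cinner_scaleC_right)
qed simp

text \<open>By polarization; over the real scalars this fails.\<close>

lemma norm_le_numerical_radius:
  fixes E :: "'a::complex_inner \<Rightarrow> 'a"
  assumes add: "\<And>x y. E (x + y) = E x + E y" and scale: "\<And>c x. E (c *\<^sub>C x) = c *\<^sub>C E x"
    and le: "\<And>x. cmod (cinner (E x) x) \<le> \<eta> * (norm x)\<^sup>2"
  shows "norm (E x) \<le> 4 * \<eta> * norm x"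
proof (cases "E x = 0 \<or> x = 0")
  case True
  have "E 0 = 0"
    using add [of 0 0] by simp
  moreover have "0 \<le> \<eta>" if "x \<noteq> 0"
    using order.trans [OF norm_ge_zero le [of x]] that by (simp add: zero_le_mult_iff)
  ultimately show ?thesis
    using True by (cases "x = 0") auto
next
  case False
  define Q where "Q v = cinner (E v) v" for v
  have Q_le: "cmod (Q (u + c *\<^sub>C v)) \<le> \<eta> * (norm u + norm v)\<^sup>2" if "cmod c = 1" for u v c
  proof -
    have "0 \<le> \<eta>"
      using order.trans [OF norm_ge_zero le [of x]] False by (simp add: zero_le_mult_iff)
    moreover have "norm (u + c *\<^sub>C v) \<le> norm u + norm v"
      using norm_triangle_ineq [of u "c *\<^sub>C v"] that by simp
    ultimately show ?thesis
      unfolding Q_def using le [of "u + c *\<^sub>C v"]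
      by (meson mult_left_mono norm_ge_zero order.trans power_mono)
  qed
  have polar: "4 * cinner (E u) v =
      (Q (u + 1 *\<^sub>C v) - Q (u + (-1) *\<^sub>C v)) + \<i> * (Q (u + \<i> *\<^sub>C v) - Q (u + (-\<i>) *\<^sub>C v))" for u v
    unfolding Q_def add scale cinner_add_left cinner_add_right cinner_scaleC_left cinner_scaleC_right
    by (simp add: algebra_simps)
  \<comment> \<open>Rescaling \<open>E x\<close> to the length of \<open>x\<close> turns each of the
    four quadratic-form bounds into \<open>\<eta> * (2 * norm x)\<^sup>2\<close>. Their sum is
    \<open>16 * \<eta> * (norm x)\<^sup>2\<close>, and the polarization factor 4 on the left leaves
    the constant 4.\<close>
  define y where "y = complex_of_real (norm x / norm (E x)) *\<^sub>C E x"
  have norm_y: "norm y = norm x"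
    using False by (simp add: y_def norm_divide)
  have "cinner (E x) y = complex_of_real (norm x * norm (E x))"
    using False by (simp add: y_def cinner_scaleC_right cinner_self power2_eq_square)
  then have "4 * (norm x * norm (E x)) = cmod (4 * cinner (E x) y)"
    by (simp add: norm_mult)
  also have "\<dots> \<le> (cmod (Q (x + 1 *\<^sub>C y)) + cmod (Q (x + (-1) *\<^sub>C y))) +
      (cmod (Q (x + \<i> *\<^sub>C y)) + cmod (Q (x + (-\<i>) *\<^sub>C y)))"
    unfolding polar
    by (intro order.trans [OF norm_triangle_ineq] add_mono norm_triangle_ineq4)
      (simp add: norm_mult norm_triangle_ineq4)
  also have "\<dots> \<le> (\<eta> * (norm x + norm y)\<^sup>2 + \<eta> * (norm x + norm y)\<^sup>2) +
      (\<eta> * (norm x + norm y)\<^sup>2 + \<eta> * (norm x + norm y)\<^sup>2)"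
    by (intro add_mono Q_le) auto
  finally have "norm x * norm (E x) \<le> norm x * (4 * \<eta> * norm x)"
    by (simp add: norm_y power2_eq_square algebra_simps)
  then show ?thesis
    using False by simp
qed

section \<open>Geometric sums on the circle\<close>

lemma circle_arc_subset: "circle_arc \<epsilon> \<subseteq> sphere 0 1"
  by (auto simp: circle_arc_def)

text \<open>The left endpoint is excluded, so the arc is exhausted by compact images of closed
  intervals whose left ends decrease to -\<epsilon>.\<close>

lemma circle_arc_in_sets: "circle_arc \<epsilon> \<in> sets circle_borel"
proof -
  have "circle_arc \<epsilon> = (\<Union>n. cis ` {- \<epsilon> + 1 / real (Suc n)..\<epsilon>})"
  proof (intro equalityI subsetI)
    fix z assume "z \<in> circle_arc \<epsilon>"
    then obtain \<theta> where \<theta>: "z = cis \<theta>" "- \<epsilon> < \<theta>" "\<theta> \<le> \<epsilon>"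
      by (auto simp: circle_arc_def)
    then obtain n where "inverse (real (Suc n)) < \<theta> + \<epsilon>"
      using reals_Archimedean [of "\<theta> + \<epsilon>"] by auto
    with \<theta> show "z \<in> (\<Union>n. cis ` {- \<epsilon> + 1 / real (Suc n)..\<epsilon>})"
      by (intro UN_I [of n] image_eqI [of _ _ \<theta>]) (auto simp: inverse_eq_divide simp del: of_nat_Suc)
  next
    fix z assume "z \<in> (\<Union>n. cis ` {- \<epsilon> + 1 / real (Suc n)..\<epsilon>})"
    then obtain n \<theta> where "z = cis \<theta>" "- \<epsilon> + 1 / real (Suc n) \<le> \<theta>" "\<theta> \<le> \<epsilon>"
      by auto
    moreover have "0 < 1 / real (Suc n)"
      by simp
    ultimately have "- \<epsilon> < \<theta>"
      by linarith
    with \<open>z = cis \<theta>\<close> \<open>\<theta> \<le> \<epsilon>\<close> show "z \<in> circle_arc \<epsilon>"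
      by (auto simp: circle_arc_def)
  qed
  moreover have "cis ` {a..b} \<in> sets borel" for a b
    by (intro borel_closed compact_imp_closed compact_continuous_image continuous_intros) auto
  ultimately have "circle_arc \<epsilon> \<in> sets borel"
    by simp
  then show ?thesis
    using circle_arc_subset [of \<epsilon>]
    by (auto simp: circle_borel_def sets_restrict_space intro!: image_eqI [of _ _ "circle_arc \<epsilon>"])
qed

lemma cos_ge_half: "1 / 2 \<le> cos t" if "\<bar>t\<bar> \<le> 1" for t :: real
proof -
  \<comment> \<open>The bound 3 < pi puts 1 below pi/3, where the cosine is 1/2.\<close>
  have "cos (pi / 3) \<le> cos \<bar>t\<bar>"
    using that pi_gt3 by (intro cos_monotone_0_pi_le) auto
  then show ?thesis
    by (simp add: cos_60)
qed

text \<open>The function sin u - u/2 vanishes at 0 and has derivative cos u - 1/2, which is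
  nonnegative on [0, 1].\<close>

lemma sin_ge_half: "t / 2 \<le> sin t" if "0 \<le> t" "t \<le> 1" for t :: real
proof -
  have "sin 0 - 0 / 2 \<le> sin t - t / 2"
  proof (rule DERIV_nonneg_imp_nondecreasing [OF that(1)])
    fix u :: real assume "0 \<le> u" "u \<le> t"
    then have "((\<lambda>u. sin u - u / 2) has_real_derivative cos u - 1 / 2) (at u)" "0 \<le> cos u - 1 / 2"
      using that cos_ge_half [of u] by (auto intro!: derivative_eq_intros)
    then show "\<exists>y. ((\<lambda>u. sin u - u / 2) has_real_derivative y) (at u) \<and> 0 \<le> y"
      by blast
  qed
  then show ?thesis
    by simp
qed

text \<open>The squared chord is 2 - 2 cos \<theta>, hence at least 4 sin(\<delta>/2)^2, and
  sin(\<delta>/2) \<ge> \<delta>/4.\<close>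

lemma norm_diff_1_outside_arc:
  assumes z: "cmod z = 1" "z \<notin> circle_arc \<delta>" and \<delta>: "0 < \<delta>" "\<delta> \<le> 1"
  shows "\<delta> / 2 \<le> cmod (z - 1)"
proof -
  define \<theta> where "\<theta> = Arg z"
  have "z \<noteq> 0"
    using z by auto
  then have z_eq: "z = cis \<theta>"
    using cis_Arg [of z] z by (simp add: \<theta>_def sgn_eq)
  have "\<bar>\<theta>\<bar> \<le> pi"
    using Arg_bounded [of z] by (auto simp: \<theta>_def)
  \<comment> \<open>The arc omits cis(-\<delta>), so equality can occur.\<close>
  moreover have "\<delta> \<le> \<bar>\<theta>\<bar>"
    using z z_eq by (force simp: circle_arc_def)
  ultimately have "cos \<bar>\<theta>\<bar> \<le> cos \<delta>"
    using \<delta> by (intro cos_monotone_0_pi_le) auto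
  moreover have "cos \<delta> = 1 - 2 * (sin (\<delta> / 2))\<^sup>2"
    using cos_double_sin [of "\<delta> / 2"] by simp
  moreover have "(\<delta> / 2 / 2)\<^sup>2 \<le> (sin (\<delta> / 2))\<^sup>2"
    using \<delta> sin_ge_half [of "\<delta> / 2"] by (intro power_mono) auto
  moreover have "(cmod (z - 1))\<^sup>2 = (cos \<theta>)\<^sup>2 + (sin \<theta>)\<^sup>2 + 1 - 2 * cos \<theta>"
    by (simp add: z_eq cmod_power2 power2_diff)
  ultimately have "(\<delta> / 2)\<^sup>2 \<le> (cmod (z - 1))\<^sup>2"
    by (simp add: power_divide)
  then show ?thesis
    by (rule power2_le_imp_le) simp
qed

text \<open>In the closed form (z^K - 1) / (z - 1) the numerator is at most 2 and the denominator at
  least \<delta>/2 in modulus.\<close>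

lemma geometric_sum_away_from_1:
  assumes "cmod z = 1" "z \<notin> circle_arc \<delta>" "0 < \<delta>" "\<delta> \<le> 1"
  shows "cmod (\<Sum>j<K. z ^ j) \<le> 4 / \<delta>"
proof -
  have dist: "\<delta> / 2 \<le> cmod (z - 1)"
    using assms by (rule norm_diff_1_outside_arc)
  then have "z \<noteq> 1"
    using assms by auto
  then have "cmod (\<Sum>j<K. z ^ j) = cmod (z ^ K - 1) / cmod (z - 1)"
    by (simp add: geometric_sum norm_divide)
  also have "\<dots> \<le> 2 / (\<delta> / 2)"
    using dist assms norm_triangle_ineq4 [of "z ^ K" 1] by (intro frac_le) (auto simp: norm_power)
  finally show ?thesis
    by simp
qed

text \<open>For j < K the angle j \<theta> stays in [-1, 1], so every real part is at least 1/2 and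
  the terms cannot cancel.\<close>

lemma geometric_sum_near_1:
  assumes "0 < K" "z \<in> circle_arc (1 / real K)"
  shows "real K / 2 \<le> cmod (\<Sum>j<K. z ^ j)"
proof -
  obtain \<theta> where z: "z = cis \<theta>" and \<theta>: "\<bar>\<theta>\<bar> \<le> 1 / real K"
    using assms by (force simp: circle_arc_def)
  have "1 / 2 \<le> cos (real j * \<theta>)" if "j < K" for j
  proof (rule cos_ge_half)
    have "\<bar>real j * \<theta>\<bar> \<le> real K * (1 / real K)"
      unfolding abs_mult using that \<theta> by (intro mult_mono) auto
    then show "\<bar>real j * \<theta>\<bar> \<le> 1"
      using assms by simp
  qed
  then have "(\<Sum>j<K. 1 / 2) \<le> (\<Sum>j<K. cos (real j * \<theta>))"
    by (intro sum_mono) auto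
  also have "\<dots> = Re (\<Sum>j<K. z ^ j)"
    by (simp add: z Complex.DeMoivre)
  also have "\<dots> \<le> cmod (\<Sum>j<K. z ^ j)"
    by (rule complex_Re_le_cmod)
  finally show ?thesis
    by simp
qed

section \<open>Norms of polynomials in a unitary operator\<close>

text \<open>Both coordinates are rounded down to a lattice of mesh 1/(n+1). Finite range on the
  circle makes the associated operator a finite sum; the values themselves may leave the
  circle.\<close>

definition grid :: "nat \<Rightarrow> complex \<Rightarrow> complex" where
  "grid n z = Complex (\<lfloor>real (Suc n) * Re z\<rfloor> / real (Suc n)) (\<lfloor>real (Suc n) * Im z\<rfloor> / real (Suc n))"

lemma dist_grid: "cmod (grid n z - z) \<le> 2 / real (Suc n)"
proof -
  have *: "\<bar>\<lfloor>real (Suc n) * t\<rfloor> / real (Suc n) - t\<bar> \<le> 1 / real (Suc n)" for t :: real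
  proof -
    have "\<bar>\<lfloor>real (Suc n) * t\<rfloor> / real (Suc n) - t\<bar> =
        \<bar>\<lfloor>real (Suc n) * t\<rfloor> - real (Suc n) * t\<bar> / real (Suc n)"
      by (subst abs_div_pos) (simp_all add: diff_divide_distrib del: of_nat_Suc)
    also have "\<dots> \<le> 1 / real (Suc n)"
      by (intro divide_right_mono) linarith+
    finally show ?thesis .
  qed
  have "cmod (grid n z - z) \<le> \<bar>Re (grid n z - z)\<bar> + \<bar>Im (grid n z - z)\<bar>"
    by (rule cmod_le)
  also have "\<dots> \<le> 1 / real (Suc n) + 1 / real (Suc n)"
    unfolding grid_def minus_complex.sel complex.sel by (intro add_mono *)
  finally show ?thesis
    by simp
qed

lemma mesh_tendsto: "(\<lambda>n. 2 / real (Suc n)) \<longlonglongrightarrow> 0"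
  by (intro LIMSEQ_Suc [where f = "\<lambda>n. 2 / real n"] lim_const_over_n)

lemma grid_tendsto: "(\<lambda>n. grid n z) \<longlonglongrightarrow> z"
proof (rule LIM_zero_cancel, rule Lim_null_comparison [OF always_eventually])
  show "\<forall>n. cmod (grid n z - z) \<le> 2 / real (Suc n)"
    by (simp add: dist_grid del: of_nat_Suc)
  show "(\<lambda>n. 2 / real (Suc n)) \<longlonglongrightarrow> 0"
    by (rule mesh_tendsto)
qed

lemma borel_measurable_grid: "grid n \<in> borel_measurable borel"
  unfolding grid_def Complex_eq by measurable

lemma finite_grid: "finite (grid n ` sphere 0 1)"
proof -
  let ?N = "int (Suc n)"
  have *: "\<lfloor>real (Suc n) * t\<rfloor> \<in> {- ?N..?N}" if "\<bar>t\<bar> \<le> 1" for t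
  proof -
    have "real (Suc n) * t \<le> real (Suc n)" "- real (Suc n) \<le> real (Suc n) * t"
      using that mult_left_mono [of t 1 "real (Suc n)"] mult_left_mono [of "- 1" t "real (Suc n)"]
      by auto
    then show ?thesis
      unfolding atLeastAtMost_iff le_floor_iff floor_le_iff of_int_minus of_int_of_nat_eq by linarith
  qed
  have "grid n z \<in> (\<lambda>(a, b). Complex (real_of_int a / real (Suc n)) (real_of_int b / real (Suc n))) `
      ({- ?N..?N} \<times> {- ?N..?N})" if "z \<in> sphere 0 1" for z
    using that *[of "Re z"] *[of "Im z"] abs_Re_le_cmod [of z] abs_Im_le_cmod [of z]
    unfolding grid_def
    by (intro image_eqI [where x = "(\<lfloor>real (Suc n) * Re z\<rfloor>, \<lfloor>real (Suc n) * Im z\<rfloor>)"]) auto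
  then have "grid n ` sphere 0 1 \<subseteq> (\<lambda>(a, b). Complex (real_of_int a / real (Suc n))
      (real_of_int b / real (Suc n))) ` ({- ?N..?N} \<times> {- ?N..?N})"
    by blast
  then show ?thesis
    by (rule finite_subset) simp
qed

section \<open>Projections and their scalar spectral measures\<close>

context
  fixes P :: "complex set \<Rightarrow> 'a::complex_inner \<Rightarrow> 'a"
  assumes P: "resolution_of_identity P"
begin

lemma measure_spectral_measure:
  "A \<in> sets circle_borel \<Longrightarrow> measure (spectral_measure P x) A = (norm (P A x))\<^sup>2"
  using emeasure_spectral_measure [OF P, of A x] by (simp add: measure_def)

lemma space_spectral_measure: "space (spectral_measure P x) = sphere 0 1"
  using sets_eq_imp_space_eq [OF sets_spectral_measure [of P x]] by simp

lemma sphere_in_sets: "sphere 0 1 \<in> sets circle_borel"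
  using sets.top [of circle_borel] by simp

lemma finite_spectral_measure: "finite_measure (spectral_measure P x)"
  by (rule finite_measureI)
    (simp add: space_spectral_measure emeasure_spectral_measure [OF P] sphere_in_sets)

lemma measure_space_spectral_measure: "measure (spectral_measure P x) (sphere 0 1) = (norm x)\<^sup>2"
  using P by (simp add: measure_spectral_measure sphere_in_sets resolution_of_identity_def)

lemma borel_measurable_spectral_measure:
  "f \<in> borel_measurable borel \<Longrightarrow> f \<in> borel_measurable (spectral_measure P x)"
  by (simp add: measurable_cong_sets [OF sets_spectral_measure refl] circle_borel_def
      measurable_restrict_space1)

lemma projection_add: "A \<in> sets circle_borel \<Longrightarrow> P A (x + y) = P A x + P A y"
  using P unfolding resolution_of_identity_def orthogonal_projection_def bounded_clinear_def
  by (simp add: linear_add bounded_linear.linear)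

lemma projection_scaleC: "A \<in> sets circle_borel \<Longrightarrow> P A (c *\<^sub>C x) = c *\<^sub>C P A x"
  using P unfolding resolution_of_identity_def orthogonal_projection_def bounded_clinear_def
  by simp

lemma projection_sum:
  "A \<in> sets circle_borel \<Longrightarrow> P A (sum f I) = (\<Sum>i\<in>I. P A (f i))"
  using P unfolding resolution_of_identity_def orthogonal_projection_def bounded_clinear_def
  by (simp add: linear_sum bounded_linear.linear)

lemma projection_Int:
  "A \<in> sets circle_borel \<Longrightarrow> B \<in> sets circle_borel \<Longrightarrow> P A (P B x) = P (A \<inter> B) x"
  using P unfolding resolution_of_identity_def by simp

lemma projection_empty: "P {} x = 0"
  using P unfolding resolution_of_identity_def by simp

lemma cinner_projection:
  assumes "A \<in> sets circle_borel" "B \<in> sets circle_borel"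
  shows "cinner (P A x) (P B x) = cinner (P (A \<inter> B) x) x"
proof -
  have "cinner (P A x) (P B x) = cinner (P B (P A x)) x"
    using P assms unfolding resolution_of_identity_def orthogonal_projection_def by metis
  then show ?thesis
    using assms by (simp add: projection_Int Int_commute)
qed

lemma cinner_projection_self:
  "A \<in> sets circle_borel \<Longrightarrow>
    cinner (P A x) x = complex_of_real (measure (spectral_measure P x) A)"
  using cinner_projection [of A A x] by (simp add: cinner_self measure_spectral_measure)

section \<open>Operator calculus for step functions\<close>

context
  fixes s :: "complex \<Rightarrow> complex"
  assumes fin: "finite (s ` sphere 0 1)" and s_meas: "s \<in> borel_measurable borel"
begin

text \<open>This is the integral of \<open>f \<circ> s\<close> against \<open>P\<close>. Since
  \<open>s\<close> is fixed while \<open>f\<close> varies, all polynomials in \<open>s\<close> share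
  the same fibres.\<close>

definition step_op :: "(complex \<Rightarrow> complex) \<Rightarrow> 'a \<Rightarrow> 'a" where
  "step_op f x = (\<Sum>c\<in>s ` sphere 0 1. f c *\<^sub>C P (s -` {c} \<inter> sphere 0 1) x)"

lemma fibre_in_sets: "s -` {c} \<inter> sphere 0 1 \<in> sets circle_borel"
proof -
  have "s -` {c} \<in> sets borel"
    using measurable_sets [OF s_meas, of "{c}"] by simp
  then show ?thesis
    by (auto simp: circle_borel_def sets_restrict_space)
qed

text \<open>On the circle the integrand is a finite combination of fibre indicators. The
  Banach-valued form covers both the real integrand of \<open>norm_step_op\<close> and the complex
  one of \<open>cinner_step_op\<close>.\<close>

lemma integral_step:
  fixes f :: "complex \<Rightarrow> 'b::{banach, second_countable_topology}"
  shows "(LINT z|spectral_measure P x. f (s z)) =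
    (\<Sum>c\<in>s ` sphere 0 1. measure (spectral_measure P x) (s -` {c} \<inter> sphere 0 1) *\<^sub>R f c)"
proof -
  interpret finite_measure "spectral_measure P x"
    by (rule finite_spectral_measure)
  let ?A = "\<lambda>c. s -` {c} \<inter> sphere 0 1"
  have "(LINT z|spectral_measure P x. f (s z)) =
      (LINT z|spectral_measure P x. (\<Sum>c\<in>s ` sphere 0 1. indicator (?A c) z *\<^sub>R f c))"
  proof (rule Bochner_Integration.integral_cong [OF refl])
    fix z assume "z \<in> space (spectral_measure P x)"
    then have "z \<in> sphere 0 1"
      by (simp add: space_spectral_measure)
    then have "(\<Sum>c\<in>s ` sphere 0 1. indicator (?A c) z *\<^sub>R f c) = (\<Sum>c\<in>s ` sphere 0 1. if c = s z then f c else 0)"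
      by (intro sum.cong) auto
    then show "f (s z) = (\<Sum>c\<in>s ` sphere 0 1. indicator (?A c) z *\<^sub>R f c)"
      using fin \<open>z \<in> sphere 0 1\<close> by simp
  qed
  also have "\<dots> = (\<Sum>c\<in>s ` sphere 0 1. (LINT z|spectral_measure P x. indicator (?A c) z *\<^sub>R f c))"
    using fibre_in_sets by (intro Bochner_Integration.integral_sum integrable_scaleR_left)
      (simp add: integrable_indicator_iff emeasure_eq_measure)
  also have "\<dots> = (\<Sum>c\<in>s ` sphere 0 1. measure (spectral_measure P x) (?A c) *\<^sub>R f c)"
    using fibre_in_sets
    by (intro sum.cong refl, subst integral_scaleR_left)
      (simp_all add: integrable_indicator_iff emeasure_eq_measure space_spectral_measure Int_assoc)
  finally show ?thesis .
qed

lemma step_op_add: "step_op f (x + y) = step_op f x + step_op f y"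
  by (simp add: step_op_def projection_add fibre_in_sets scaleC_add_right sum.distrib)

lemma step_op_scaleC: "step_op f (c *\<^sub>C x) = c *\<^sub>C step_op f x"
  by (simp add: step_op_def projection_scaleC fibre_in_sets scaleC_sum_right scaleC_scaleC mult.commute)

text \<open>Fibres over distinct values are disjoint, so the mixed products of projections vanish
  and only the diagonal terms survive.\<close>

lemma step_op_mult: "step_op f (step_op g x) = step_op (\<lambda>c. f c * g c) x"
proof -
  let ?A = "\<lambda>c. s -` {c} \<inter> sphere 0 1"
  have "P (?A c) (step_op g x) = g c *\<^sub>C P (?A c) x" if "c \<in> s ` sphere 0 1" for c
  proof -
    have "P (?A c) (step_op g x) = (\<Sum>d\<in>s ` sphere 0 1. g d *\<^sub>C P (?A c \<inter> ?A d) x)"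
      by (simp add: step_op_def projection_sum projection_scaleC projection_Int fibre_in_sets
          del: Int_assoc)
    also have "\<dots> = (\<Sum>d\<in>s ` sphere 0 1. if d = c then g c *\<^sub>C P (?A c) x else 0)"
    proof (intro sum.cong refl)
      fix d
      have "?A c \<inter> ?A d = (if d = c then ?A c else {})"
        by auto
      then show "g d *\<^sub>C P (?A c \<inter> ?A d) x = (if d = c then g c *\<^sub>C P (?A c) x else 0)"
        by (simp add: projection_empty)
    qed
    finally show ?thesis
      using that fin by simp
  qed
  then show ?thesis
    unfolding step_op_def [of f] step_op_def [of "\<lambda>c. f c * g c"]
    by (intro sum.cong refl) (simp add: scaleC_scaleC)
qed

text \<open>Disjoint fibres give mutually orthogonal summands, so Pythagoras reduces the norm to a
  sum over fibres.\<close>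

lemma norm_step_op:
  "(norm (step_op f x))\<^sup>2 = (LINT z|spectral_measure P x. (cmod (f (s z)))\<^sup>2)"
proof -
  let ?A = "\<lambda>c. s -` {c} \<inter> sphere 0 1"
  have "(norm (step_op f x))\<^sup>2 = (\<Sum>c\<in>s ` sphere 0 1. (norm (f c *\<^sub>C P (?A c) x))\<^sup>2)"
    unfolding step_op_def
  proof (rule norm_sum_orthogonal [OF fin])
    fix c d :: complex assume "c \<noteq> d"
    then have "?A c \<inter> ?A d = {}"
      by auto
    then show "cinner (f c *\<^sub>C P (?A c) x) (f d *\<^sub>C P (?A d) x) = 0"
      by (simp only: cinner_scaleC_left cinner_scaleC_right cinner_projection fibre_in_sets
          projection_empty cinner_zero_left mult_zero_right)
  qed
  also have "\<dots> = (LINT z|spectral_measure P x. (cmod (f (s z)))\<^sup>2)"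
    by (subst integral_step)
      (simp add: measure_spectral_measure fibre_in_sets power_mult_distrib mult.commute)
  finally show ?thesis .
qed

text \<open>This has the shape of the formula that ties \<open>U\<close> to \<open>P\<close>, so
  that the quadratic forms of \<open>U\<close> and of a step operator can be compared.\<close>

lemma cinner_step_op: "cinner (step_op f x) x = (LINT z|spectral_measure P x. f (s z))"
  by (subst integral_step) (simp add: step_op_def cinner_sum_left cinner_scaleC_left
      cinner_projection_self fibre_in_sets scaleR_conv_of_real mult.commute)

text \<open>An equality case of Cauchy-Schwarz: the image has the norm of \<open>x\<close> and inner
  product \<open>(norm x)\<^sup>2\<close> with \<open>x\<close>, so its distance to \<open>x\<close>
  is 0.\<close>

lemma step_op_one: "step_op (\<lambda>_. 1) x = x"
proof -
  have "(norm (step_op (\<lambda>_. 1) x))\<^sup>2 = (norm x)\<^sup>2"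
    by (simp add: norm_step_op space_spectral_measure measure_space_spectral_measure)
  moreover have "cinner (step_op (\<lambda>_. 1) x) x = complex_of_real ((norm x)\<^sup>2)"
    by (simp add: cinner_step_op space_spectral_measure measure_space_spectral_measure
        scaleR_conv_of_real)
  ultimately have "(norm (step_op (\<lambda>_. 1) x - x))\<^sup>2 = 0"
    by (simp add: norm_diff_square flip: of_real_power)
  then show ?thesis
    by simp
qed

end

text \<open>Step operators of the identity approximate \<open>U\<close> in operator norm, and
  multiplicativity of the step calculus carries this over to powers by induction.\<close>

lemma step_op_tendsto_power:
  assumes U: "bounded_clinear U"
    and diag: "\<And>x. cinner (U x) x = (LINT z|spectral_measure P x. z)"
  shows "(\<lambda>n. step_op (grid n) (\<lambda>c. c ^ j) x) \<longlonglongrightarrow> (U ^^ j) x"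
proof (induction j)
  case 0
  show ?case
    by (simp add: step_op_one [OF finite_grid borel_measurable_grid])
next
  case (Suc j)
  define T where "T n f y = step_op (grid n) f y" for n f y
  note grid = finite_grid borel_measurable_grid
  have lin: "linear U" and scale: "\<And>c y. U (c *\<^sub>C y) = c *\<^sub>C U y"
    using U by (auto simp: bounded_clinear_def bounded_linear.linear)
  \<comment> \<open>Only quadratic forms can be compared directly;
    \<open>norm_le_numerical_radius\<close> upgrades this to a norm bound. Uniformity in
    \<open>y\<close> matters, because below the bound is applied to vectors that vary with
    \<open>n\<close>.\<close>
  have close: "norm (U y - T n (\<lambda>c. c) y) \<le> 4 * (2 / real (Suc n)) * norm y" for n y
  proof (rule norm_le_numerical_radius)
    fix y
    interpret finite_measure "spectral_measure P y"
      by (rule finite_spectral_measure)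
    have int: "integrable (spectral_measure P y) (\<lambda>z. z)"
      by (rule integrable_const_bound [where B = 1])
        (auto simp: space_spectral_measure intro: borel_measurable_spectral_measure)
    have meas: "grid n \<in> borel_measurable (spectral_measure P y)"
      by (intro borel_measurable_spectral_measure borel_measurable_grid)
    have bound: "cmod (z - grid n z) \<le> 2 / real (Suc n)" for z
      by (subst norm_minus_commute) (rule dist_grid)
    have int': "integrable (spectral_measure P y) (\<lambda>z. z - grid n z)"
      by (rule integrable_const_bound [where B = "2 / real (Suc n)"])
        (intro AE_I2 bound, intro borel_measurable_diff borel_measurable_integrable [OF int] meas)
    have int'': "integrable (spectral_measure P y) (grid n)"
      using Bochner_Integration.integrable_diff [OF int int'] by simp
    have "cinner (U y - T n (\<lambda>c. c) y) y = (LINT z|spectral_measure P y. z - grid n z)"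
      unfolding cinner_diff_left diag T_def cinner_step_op [OF grid]
      by (rule Bochner_Integration.integral_diff [symmetric, OF int int''])
    also have "cmod \<dots> \<le> (LINT z|spectral_measure P y. 2 / real (Suc n))"
      using bound by (rule Bochner_Integration.integral_norm_bound_integral [OF int' integrable_const])
    also have "\<dots> = 2 / real (Suc n) * (norm y)\<^sup>2"
      by (simp add: space_spectral_measure measure_space_spectral_measure)
    finally show "cmod (cinner (U y - T n (\<lambda>c. c) y) y) \<le> 2 / real (Suc n) * (norm y)\<^sup>2" .
  qed (simp_all add: T_def linear_add [OF lin] scale step_op_add [OF grid] step_op_scaleC [OF grid]
      scaleC_diff_right)
  have IH: "(\<lambda>n. T n (\<lambda>c. c ^ j) x) \<longlonglongrightarrow> (U ^^ j) x"
    using Suc.IH by (simp add: T_def)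
  \<comment> \<open>The vectors to which \<open>close\<close> is applied converge by the induction
    hypothesis, so their norms do not spoil the factor of order 1/(n+1).\<close>
  have "(\<lambda>n. 4 * (2 / real (Suc n)) * norm (T n (\<lambda>c. c ^ j) x)) \<longlonglongrightarrow> 4 * 0 * norm ((U ^^ j) x)"
    by (intro tendsto_mult tendsto_norm tendsto_const IH mesh_tendsto)
  then have "(\<lambda>n. U (T n (\<lambda>c. c ^ j) x) - T n (\<lambda>c. c) (T n (\<lambda>c. c ^ j) x)) \<longlonglongrightarrow> 0"
    unfolding mult_zero_right mult_zero_left
    by (rule Lim_null_comparison [OF always_eventually [OF allI [OF close]]])
  moreover have "(\<lambda>n. U (T n (\<lambda>c. c ^ j) x)) \<longlonglongrightarrow> U ((U ^^ j) x)"
    using U IH by (auto simp: bounded_clinear_def intro: bounded_linear.tendsto)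
  ultimately have "(\<lambda>n. U (T n (\<lambda>c. c ^ j) x)
      - (U (T n (\<lambda>c. c ^ j) x) - T n (\<lambda>c. c) (T n (\<lambda>c. c ^ j) x))) \<longlonglongrightarrow> U ((U ^^ j) x) - 0"
    by (intro tendsto_diff)
  then show ?case
    by (simp add: T_def step_op_mult [OF grid])
qed

text \<open>Both sides are limits of the same sequence, namely the identity
  \<open>norm_step_op\<close> for the polynomial evaluated on finer and finer grids.\<close>

lemma norm_sum_powers:
  assumes U: "bounded_clinear U"
    and diag: "\<And>x. cinner (U x) x = (LINT z|spectral_measure P x. z)"
  shows "(norm (\<Sum>j<K. (U ^^ j) x))\<^sup>2 = (LINT z|spectral_measure P x. (cmod (\<Sum>j<K. z ^ j))\<^sup>2)"
proof (rule LIMSEQ_unique)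
  interpret finite_measure "spectral_measure P x"
    by (rule finite_spectral_measure)
  let ?T = "\<lambda>n f. step_op (grid n) f x"
  note grid = finite_grid borel_measurable_grid
  have "(\<lambda>n. (norm (\<Sum>j<K. ?T n (\<lambda>c. c ^ j)))\<^sup>2) \<longlonglongrightarrow> (norm (\<Sum>j<K. (U ^^ j) x))\<^sup>2"
    by (intro tendsto_intros step_op_tendsto_power U diag)
  moreover have "(\<Sum>j<K. ?T n (\<lambda>c. c ^ j)) = ?T n (\<lambda>c. \<Sum>j<K. c ^ j)" for n
    unfolding step_op_def [OF grid] scaleC_sum_left by (rule sum.swap)
  ultimately show "(\<lambda>n. LINT z|spectral_measure P x. (cmod (\<Sum>j<K. grid n z ^ j))\<^sup>2)
      \<longlonglongrightarrow> (norm (\<Sum>j<K. (U ^^ j) x))\<^sup>2"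
    by (simp add: norm_step_op [OF grid])
  show "(\<lambda>n. LINT z|spectral_measure P x. (cmod (\<Sum>j<K. grid n z ^ j))\<^sup>2)
      \<longlonglongrightarrow> (LINT z|spectral_measure P x. (cmod (\<Sum>j<K. z ^ j))\<^sup>2)"
  \<comment> \<open>The constant 3 bounds the modulus of a rounded point of the circle: 1 plus a
    rounding error of at most 2.\<close>
  proof (rule integral_dominated_convergence [where w = "\<lambda>_. (\<Sum>j<K. 3 ^ j)\<^sup>2"])
    show "AE z in spectral_measure P x.
        (\<lambda>n. (cmod (\<Sum>j<K. grid n z ^ j))\<^sup>2) \<longlonglongrightarrow> (cmod (\<Sum>j<K. z ^ j))\<^sup>2"
      by (intro always_eventually allI tendsto_intros grid_tendsto)
    show "AE z in spectral_measure P x.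
        norm ((cmod (\<Sum>j<K. grid n z ^ j))\<^sup>2) \<le> (\<Sum>j<K. 3 ^ j)\<^sup>2" for n
    proof (rule AE_I2)
      fix z assume "z \<in> space (spectral_measure P x)"
      then have "cmod z = 1"
        by (simp add: space_spectral_measure)
      moreover have "2 / real (Suc n) \<le> 2"
        by (simp add: field_simps)
      ultimately have "cmod (grid n z) \<le> 3"
        using dist_grid [of n z] norm_triangle_sub [of "grid n z" z] by linarith
      then show "norm ((cmod (\<Sum>j<K. grid n z ^ j))\<^sup>2) \<le> (\<Sum>j<K. 3 ^ j)\<^sup>2"
        by (auto intro!: power_mono sum_norm_le simp: norm_power)
    qed
  qed (auto intro!: borel_measurable_spectral_measure borel_measurable_grid
      borel_measurable_power borel_measurable_norm borel_measurable_sum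
      measurable_compose [OF borel_measurable_grid])
qed

section \<open>Ergodic averages and the measure of arcs\<close>

lemma average_square_bounds:
  assumes U: "bounded_clinear U"
    and diag: "\<And>x. cinner (U x) x = (LINT z|spectral_measure P x. z)"
    and K: "0 < K"
  shows "measure (spectral_measure P x) (circle_arc (1 / real K)) / 4
      \<le> (norm ((1 / real K) *\<^sub>R (\<Sum>j<K. (U ^^ j) x)))\<^sup>2" (is "?lower")
    and "0 < \<delta> \<Longrightarrow> \<delta> \<le> 1 \<Longrightarrow> (norm ((1 / real K) *\<^sub>R (\<Sum>j<K. (U ^^ j) x)))\<^sup>2
      \<le> measure (spectral_measure P x) (circle_arc \<delta>) + 16 * (norm x)\<^sup>2 / (\<delta>\<^sup>2 * (real K)\<^sup>2)"
proof -
  let ?M = "spectral_measure P x"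
  let ?D = "(norm ((1 / real K) *\<^sub>R (\<Sum>j<K. (U ^^ j) x)))\<^sup>2"
  interpret finite_measure ?M
    by (rule finite_spectral_measure)
  have D: "?D = (LINT z|?M. (cmod (\<Sum>j<K. z ^ j))\<^sup>2) / (real K)\<^sup>2"
    by (simp add: power_divide norm_sum_powers [OF U diag])
  have le_K: "(cmod (\<Sum>j<K. z ^ j))\<^sup>2 \<le> (real K)\<^sup>2" if "cmod z = 1" for z
  proof (rule power_mono)
    show "cmod (\<Sum>j<K. z ^ j) \<le> real K"
      using sum_norm_le [of "{..<K}" "\<lambda>j. z ^ j" "\<lambda>_. 1"] that by (simp add: norm_power)
  qed simp
  have int: "integrable ?M (\<lambda>z. (cmod (\<Sum>j<K. z ^ j))\<^sup>2)"
    by (rule integrable_const_bound [where B = "(real K)\<^sup>2"])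
      (auto simp: space_spectral_measure le_K simp del: power_mono_iff abs_power2
        intro!: AE_I2 borel_measurable_spectral_measure)
  have int_arc: "integrable ?M (\<lambda>z. indicat_real (circle_arc \<epsilon>) z * c)" for \<epsilon> c
    by (intro integrable_mult_left) (simp add: circle_arc_in_sets emeasure_eq_measure)
  have integral_arc: "(LINT z|?M. indicat_real (circle_arc \<epsilon>) z * c) = measure ?M (circle_arc \<epsilon>) * c"
    for \<epsilon> c
    using circle_arc_subset [of \<epsilon>]
    by (simp add: circle_arc_in_sets emeasure_eq_measure space_spectral_measure Int_absorb2)
  \<comment> \<open>Discarding the complement of the arc keeps (K/2)^2 on it; the normalization by
    K^2 then gives the factor 1/4.\<close>
  have "measure ?M (circle_arc (1 / real K)) * (real K / 2)\<^sup>2 \<le> (LINT z|?M. (cmod (\<Sum>j<K. z ^ j))\<^sup>2)"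
    unfolding integral_arc [symmetric]
    using geometric_sum_near_1 [OF K]
    by (intro integral_mono int int_arc) (auto simp: indicator_def intro!: power_mono)
  then show ?lower
    unfolding D using K by (simp add: field_simps power2_eq_square)
  assume \<delta>: "0 < \<delta>" "\<delta> \<le> 1"
  \<comment> \<open>The sum of the two bounds dominates in both cases, so the integral need not be
    split. The constant is integrated over the total mass \<open>(norm x)\<^sup>2\<close>.\<close>
  have "(LINT z|?M. (cmod (\<Sum>j<K. z ^ j))\<^sup>2)
      \<le> (LINT z|?M. indicat_real (circle_arc \<delta>) z * (real K)\<^sup>2 + (4 / \<delta>)\<^sup>2)"
  proof (intro integral_mono int Bochner_Integration.integrable_add int_arc integrable_const)
    fix z assume "z \<in> space ?M"
    then have z: "cmod z = 1"
      by (simp add: space_spectral_measure)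
    show "(cmod (\<Sum>j<K. z ^ j))\<^sup>2 \<le> indicat_real (circle_arc \<delta>) z * (real K)\<^sup>2 + (4 / \<delta>)\<^sup>2"
    proof (cases "z \<in> circle_arc \<delta>")
      case True
      then show ?thesis
        using add_mono [OF le_K [OF z] zero_le_power2 [of "4 / \<delta>"]] by simp
    next
      case False
      then show ?thesis
        using power_mono [OF geometric_sum_away_from_1 [OF z False \<delta>], of K 2] by simp
    qed
  qed
  also have "\<dots> = measure ?M (circle_arc \<delta>) * (real K)\<^sup>2 + (4 / \<delta>)\<^sup>2 * (norm x)\<^sup>2"
    by (subst Bochner_Integration.integral_add [OF int_arc integrable_const])
      (simp add: integral_arc space_spectral_measure measure_space_spectral_measure
        Int_absorb2 [OF circle_arc_subset])
  finally show "?D \<le> measure ?M (circle_arc \<delta>) + 16 * (norm x)\<^sup>2 / (\<delta>\<^sup>2 * (real K)\<^sup>2)"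
    unfolding D using K \<delta> by (simp add: field_simps power2_eq_square)
qed

text \<open>The spectral measure of y = \<open>P {1} x\<close> is concentrated at 1, so
  \<open>cinner (U y) y\<close> equals \<open>(norm y)\<^sup>2\<close>. As \<open>U\<close>
  preserves norms, expanding the square of \<open>norm (U y - y)\<close> gives 0.\<close>

lemma fixed_by_unitary:
  assumes U: "unitary_op U"
    and diag: "\<And>x. cinner (U x) x = (LINT z|spectral_measure P x. z)"
  shows "U (P {1} x) = P {1} x"
proof -
  let ?y = "P {1} x"
  have one: "{1} \<in> sets circle_borel"
    by (auto simp: circle_borel_def sets_restrict_space intro!: image_eqI [where x = "{1}"])
  then have diff: "sphere 0 1 - {1} \<in> sets circle_borel"
    using sphere_in_sets by (rule sets.Diff [rotated])
  have "measure (spectral_measure P ?y) (sphere 0 1 - {1}) = 0"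
    by (simp add: measure_spectral_measure diff projection_Int one projection_empty)
  then have "AE z in spectral_measure P ?y. z = 1"
    using diff finite_measure.emeasure_eq_measure [OF finite_spectral_measure]
    by (intro AE_I [where N = "sphere 0 1 - {1}"]) (auto simp: space_spectral_measure)
  then have "cinner (U ?y) ?y = (LINT z|spectral_measure P ?y. 1)"
    unfolding diag
    by (intro integral_cong_AE) (auto intro: borel_measurable_spectral_measure)
  also have "\<dots> = complex_of_real ((norm ?y)\<^sup>2)"
    by (simp add: space_spectral_measure measure_space_spectral_measure scaleR_conv_of_real)
  finally have "Re (cinner (U ?y) ?y) = (norm ?y)\<^sup>2"
    by (simp flip: of_real_power)
  moreover have "complex_of_real ((norm (U ?y))\<^sup>2) = complex_of_real ((norm ?y)\<^sup>2)"
    using U unfolding cinner_self [symmetric] unitary_op_def by blast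
  ultimately have "(norm (U ?y - ?y))\<^sup>2 = 0"
    unfolding norm_diff_square of_real_eq_iff by simp
  then show ?thesis
    by simp
qed

text \<open>The vector \<open>P {1} x\<close> is fixed by \<open>U\<close>, hence equal to its own
  average, and can be subtracted inside the sum.\<close>

lemma ergodic_deviation_eq:
  assumes U: "unitary_op U"
    and diag: "\<And>x. cinner (U x) x = (LINT z|spectral_measure P x. z)"
    and K: "0 < K"
  shows "ergodic_deviation U P x K = norm ((1 / real K) *\<^sub>R (\<Sum>j<K. (U ^^ j) (x - P {1} x)))"
proof -
  have lin: "linear U"
    using U by (auto simp: unitary_op_def bounded_clinear_def bounded_linear.linear)
  have "(U ^^ j) (x - P {1} x) = (U ^^ j) x - P {1} x" for j
    by (induction j) (simp_all add: linear_diff [OF lin] fixed_by_unitary [OF U diag])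
  moreover have "(1 / real K) *\<^sub>R (\<Sum>j<K. P {1} x) = P {1} x"
    using K by (simp add: sum_constant_scaleR)
  ultimately show ?thesis
    by (simp only: ergodic_deviation_def sum_subtractf scaleR_diff_right)
qed

end

text \<open>What remains is real analysis: \<open>D\<close> stands for the squared deviation,
  \<open>B\<close> bounds the mass of all arcs, and \<open>C\<close> is the constant of the error
  term off the arc.\<close>

lemma exponents_at_1:
  fixes D :: "nat \<Rightarrow> real" and \<mu> :: "complex measure"
  assumes le: "\<And>\<epsilon>. measure \<mu> (circle_arc \<epsilon>) \<le> B"
    and lower: "\<And>K. 0 < K \<Longrightarrow> measure \<mu> (circle_arc (1 / real K)) / 4 \<le> D K"
    and upper: "\<And>K \<delta>. 0 < K \<Longrightarrow> 0 < \<delta> \<Longrightarrow> \<delta> \<le> 1 \<Longrightarrow>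
      D K \<le> measure \<mu> (circle_arc \<delta>) + C / (\<delta>\<^sup>2 * (real K)\<^sup>2)"
    and limsup: "\<And>\<epsilon>. 0 < \<epsilon> \<Longrightarrow> limsup (\<lambda>K. ereal (real K powr \<epsilon> * D K)) = \<infinity>"
    and liminf: "\<And>\<epsilon>. 0 < \<epsilon> \<Longrightarrow> liminf (\<lambda>K. ereal (real K powr (2 - \<epsilon>) * D K)) = 0"
  shows "lower_exponent_at_1 \<mu> = 0" and "2 \<le> upper_exponent_at_1 \<mu>"
proof -
  define m where "m \<epsilon> = measure \<mu> (circle_arc \<epsilon>)" for \<epsilon>
  \<comment> \<open>The limsup hypothesis in contrapositive form: \<open>D\<close> admits no
    polynomial rate of decay.\<close>
  have unbounded: False
    if "0 < \<epsilon>" "\<forall>\<^sub>F K in sequentially. real K powr \<epsilon> * D K \<le> R" for \<epsilon> R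
  proof -
    have "limsup (\<lambda>K. ereal (real K powr \<epsilon> * D K)) \<le> ereal R"
      by (rule Limsup_bounded) (use that in simp)
    then show False
      using limsup [OF that(1)] by simp
  qed
  \<comment> \<open>A null arc would leave only the error term at fixed \<epsilon>, and thus the
    rate K^(-2).\<close>
  have pos: "0 < m \<epsilon>" if \<epsilon>: "0 < \<epsilon>" "\<epsilon> \<le> 1" for \<epsilon>
  proof (rule ccontr)
    assume "\<not> 0 < m \<epsilon>"
    then have "D K \<le> C / (\<epsilon>\<^sup>2 * (real K)\<^sup>2)" if "0 < K" for K
      using upper [OF that \<epsilon>] by (simp add: m_def)
    then have "real K powr 2 * D K \<le> C / \<epsilon>\<^sup>2" if "0 < K" for K
      using that \<epsilon> by (simp add: field_simps powr_numeral)
    then show False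
      by (intro unbounded [of 2 "C / \<epsilon>\<^sup>2"] eventually_mono [OF eventually_gt_at_top [of 0]]) auto
  qed
  have ev1: "\<forall>\<^sub>F \<epsilon> in at_right 0. 0 < \<epsilon> \<and> \<epsilon> < (1::real)"
    by (auto simp: eventually_at_right_field intro!: exI [of _ 1])
  \<comment> \<open>This rules out the default value \<infinity> in both exponents.\<close>
  then have ev_pos: "\<forall>\<^sub>F \<epsilon> in at_right 0. measure \<mu> (circle_arc \<epsilon>) > 0"
    by eventually_elim (use pos in \<open>auto simp: m_def\<close>)
  let ?q = "\<lambda>\<epsilon>. ereal (ln (m \<epsilon>) / ln \<epsilon>)"
  have B: "0 < B"
    using pos [of 1] le [of 1] by (simp add: m_def)
  have "0 \<le> Liminf (at_right 0) ?q"
  proof -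
    \<comment> \<open>Since ln \<epsilon> < 0, the bound \<open>m \<epsilon> \<le> B\<close> makes
      ln B / ln \<epsilon> a minorant of the quotient, and this minorant tends to 0.\<close>
    have "((\<lambda>\<epsilon>. ln B / ln \<epsilon>) \<longlongrightarrow> 0) (at_right 0)"
      by (intro tendsto_divide_0 [OF tendsto_const] filterlim_at_bot_imp_at_infinity ln_at_0)
    then have lim: "Liminf (at_right 0) (\<lambda>\<epsilon>. ereal (ln B / ln \<epsilon>)) = 0"
      by (intro lim_imp_Liminf) (auto simp: zero_ereal_def)
    have "\<forall>\<^sub>F \<epsilon> in at_right 0. ereal (ln B / ln \<epsilon>) \<le> ?q \<epsilon>"
      using ev1
    proof eventually_elim
      case (elim \<epsilon>)
      have "ln (m \<epsilon>) \<le> ln B"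
        using pos [of \<epsilon>] le [of \<epsilon>] elim B by (simp add: m_def)
      then show ?case
        using elim by (simp add: divide_right_mono_neg)
    qed
    from Liminf_mono [OF this] show ?thesis
      unfolding lim .
  qed
  moreover have "Liminf (at_right 0) ?q \<le> 0"
  proof (rule ccontr)
    assume "\<not> ?thesis"
    then obtain a where a: "0 < a" "ereal a < Liminf (at_right 0) ?q"
      using ereal_dense2 [of 0 "Liminf (at_right 0) ?q"] by (auto simp: not_le)
    \<comment> \<open>The liminf is sampled along \<delta> = K^(-1/2), which tends to 0 while
      \<delta> K still tends to infinity.\<close>
    have lim: "filterlim (\<lambda>K::nat. real K powr (- 1/2)) (at_right 0) sequentially"
      by (intro tendsto_imp_filterlim_at_right tendsto_neg_powr filterlim_real_sequentially
          eventually_mono [OF eventually_gt_at_top [of 0]]) auto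
    have "\<forall>\<^sub>F K in sequentially. a < ln (m (real K powr (- 1/2))) / ln (real K powr (- 1/2))"
      using filterlim_iff [THEN iffD1, OF lim, rule_format, OF less_LiminfD [OF a(2)]] by simp
    \<comment> \<open>The arc contributes K^(-a/2) and the error term K^(-1); the minimum is the
      slower of the two rates.\<close>
    then have "\<forall>\<^sub>F K in sequentially. real K powr min (a / 2) 1 * D K \<le> 1 + \<bar>C\<bar>"
      using eventually_gt_at_top [of "1::nat"]
    proof eventually_elim
      case (elim K)
      define \<delta> where "\<delta> = real K powr (- 1/2)"
      have \<delta>: "0 < \<delta>" "\<delta> < 1"
        using elim by (auto simp: \<delta>_def powr_less_one)
      \<comment> \<open>Multiplication by ln \<delta> < 0 reverses the inequality; K > 1 ensures
        this sign.\<close>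
      have "ln (m \<delta>) < a * ln \<delta>"
        using elim(1) \<delta> unfolding \<delta>_def [symmetric] by (simp add: less_divide_eq)
      also have "a * ln \<delta> = ln (\<delta> powr a)"
        using \<delta> by (simp add: ln_powr)
      finally have "m \<delta> < \<delta> powr a"
        by (subst (asm) ln_less_cancel_iff) (use \<delta> pos [of \<delta>] in simp_all)
      also have "\<delta> powr a = real K powr - (a / 2)"
        by (simp add: \<delta>_def powr_powr)
      finally have m_le: "m \<delta> \<le> real K powr - min (a / 2) 1"
        using elim by (auto elim!: order_less_le_trans [THEN less_imp_le] intro!: powr_mono)
      have "\<delta>\<^sup>2 = \<delta> powr 2"
        using \<delta> by simp
      also have "\<dots> = 1 / real K"
        unfolding \<delta>_def powr_powr using elim by (simp add: powr_minus_divide)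
      finally have \<delta>2: "\<delta>\<^sup>2 * (real K)\<^sup>2 = real K"
        by (simp add: power2_eq_square)
      have "C / real K \<le> \<bar>C\<bar> * real K powr - 1"
        using elim by (simp add: powr_minus divide_simps)
      also have "\<dots> \<le> \<bar>C\<bar> * real K powr - min (a / 2) 1"
        using elim by (intro mult_left_mono powr_mono) auto
      finally have "D K \<le> (1 + \<bar>C\<bar>) * real K powr - min (a / 2) 1"
        using upper [of K \<delta>] elim \<delta> m_le by (simp add: \<delta>2 m_def algebra_simps)
      then have "real K powr min (a / 2) 1 * D K
          \<le> real K powr min (a / 2) 1 * ((1 + \<bar>C\<bar>) * real K powr - min (a / 2) 1)"
        by (intro mult_left_mono) auto
      also have "\<dots> = (1 + \<bar>C\<bar>) * real K powr (min (a / 2) 1 + - min (a / 2) 1)"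
        by (simp only: powr_add mult.left_commute)
      finally show ?case
        using elim by simp
    qed
    then show False
      using unbounded [of "min (a / 2) 1"] a by auto
  qed
  ultimately show "lower_exponent_at_1 \<mu> = 0"
    using ev_pos by (simp add: lower_exponent_at_1_def m_def)
  have "2 \<le> Limsup (at_right 0) ?q"
  proof (rule ccontr)
    assume "\<not> ?thesis"
    \<comment> \<open>A real number strictly between the limsup and 2 forces
      \<open>m (1 / K)\<close> to exceed K^(-a) for all large K, and through \<open>lower\<close>
      keeps K^a D(K) at or above 1/4.\<close>
    then obtain a where a: "a < 2" "Limsup (at_right 0) ?q < ereal a"
      using ereal_dense2 [of "Limsup (at_right 0) ?q" 2] by (auto simp: not_le)
    have lim: "filterlim (\<lambda>K::nat. 1 / real K) (at_right 0) sequentially"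
      by (intro tendsto_imp_filterlim_at_right lim_1_over_n
          eventually_mono [OF eventually_gt_at_top [of 0]]) auto
    have "\<forall>\<^sub>F K in sequentially. ln (m (1 / real K)) / ln (1 / real K) < a"
      using filterlim_iff [THEN iffD1, OF lim, rule_format, OF Limsup_lessD [OF a(2)]] by simp
    then have "\<forall>\<^sub>F K in sequentially. 1 / 4 \<le> real K powr a * D K"
      using eventually_gt_at_top [of "1::nat"]
    proof eventually_elim
      case (elim K)
      have "ln (1 / real K) < 0"
        using elim by (simp add: ln_div)
      from elim(1) have "a * ln (1 / real K) < ln (m (1 / real K))"
        unfolding neg_divide_less_eq [OF \<open>ln (1 / real K) < 0\<close>] .
      also have "a * ln (1 / real K) = ln (real K powr - a)"
        using elim by (simp add: ln_powr ln_div)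
      finally have "real K powr - a < m (1 / real K)"
        by (subst (asm) ln_less_cancel_iff) (use elim pos [of "1 / real K"] in simp_all)
      then have "real K powr a * (real K powr - a / 4) \<le> real K powr a * D K"
        using lower [of K] elim by (intro mult_left_mono) (auto simp: m_def)
      then show ?case
        using elim by (simp add: powr_minus)
    qed
    \<comment> \<open>The exponent a is written as 2 - (2 - a) to match \<open>liminf\<close> at the
      positive value 2 - a, where the liminf is 0.\<close>
    then have "ereal (1 / 4) \<le> liminf (\<lambda>K. ereal (real K powr (2 - (2 - a)) * D K))"
      by (intro Liminf_bounded) simp
    then show False
      using liminf [of "2 - a"] a by simp
  qed
  then show "2 \<le> upper_exponent_at_1 \<mu>"
    using ev_pos by (simp add: upper_exponent_at_1_def m_def)
qed

theorem corollary1: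
  fixes U :: "'a::complex_hilbert_space \<Rightarrow> 'a"
    and P :: "complex set \<Rightarrow> 'a \<Rightarrow> 'a"
    and \<psi> :: 'a
  assumes separable: "\<exists>D :: 'a set. countable D \<and> closure D = UNIV"
    and unitary: "unitary_op U"
    and P: "resolution_of_identity_of U P"
    and accumulation: "1 islimpt op_spectrum U"
    and weak_limit: "wot_tendsto_zero (\<lambda>j. (U \<circ> P (sphere 0 1 - {1})) ^^ j)"
    and \<psi>: "\<psi> \<in> G_set U P"
  shows "0 = lower_exponent_at_1 (spectral_measure P (\<psi> - P {1} \<psi>)) \<and>
         lower_exponent_at_1 (spectral_measure P (\<psi> - P {1} \<psi>)) < 2 \<and>
         2 \<le> upper_exponent_at_1 (spectral_measure P (\<psi> - P {1} \<psi>))"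
proof -
  let ?\<phi> = "\<psi> - P {1} \<psi>"
  let ?\<mu> = "spectral_measure P ?\<phi>"
  let ?D = "\<lambda>K. (ergodic_deviation U P \<psi> K)\<^sup>2"
  have roi: "resolution_of_identity P"
    and diag: "\<And>x. cinner (U x) x = (LINT z|spectral_measure P x. z)"
    using P by (auto simp: resolution_of_identity_of_def)
  have U: "bounded_clinear U"
    using unitary by (simp add: unitary_op_def)
  \<comment> \<open>At K = 0 the deviation is the norm of \<open>P {1} \<psi>\<close>, since 1/0 =
    0, whereas the right-hand side is 0; the limits in K do not see this term.\<close>
  have dev: "0 < K \<Longrightarrow> ?D K = (norm ((1 / real K) *\<^sub>R (\<Sum>j<K. (U ^^ j) ?\<phi>)))\<^sup>2" for K
    by (simp only: ergodic_deviation_eq [OF roi unitary diag])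
  \<comment> \<open>The total mass of the spectral measure serves as the constant \<open>B\<close>
    of \<open>exponents_at_1\<close>.\<close>
  have le: "measure ?\<mu> (circle_arc \<epsilon>) \<le> measure ?\<mu> (space ?\<mu>)" for \<epsilon>
    by (rule finite_measure.bounded_measure [OF finite_spectral_measure [OF roi]])
  have lower: "measure ?\<mu> (circle_arc (1 / real K)) / 4 \<le> ?D K" if "0 < K" for K
    unfolding dev [OF that] by (rule average_square_bounds(1) [OF roi U diag that])
  have upper: "?D K \<le> measure ?\<mu> (circle_arc \<delta>) + 16 * (norm ?\<phi>)\<^sup>2 / (\<delta>\<^sup>2 * (real K)\<^sup>2)"
    if "0 < K" "0 < \<delta>" "\<delta> \<le> 1" for K \<delta>
    unfolding dev [OF that(1)] by (rule average_square_bounds(2) [OF roi U diag that])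
  have limsup: "limsup (\<lambda>K. ereal (real K powr \<epsilon> * ?D K)) = \<infinity>"
    and liminf: "liminf (\<lambda>K. ereal (real K powr (2 - \<epsilon>) * ?D K)) = 0" if "0 < \<epsilon>" for \<epsilon>
    using \<psi> that by (auto simp: G_set_def)
  show ?thesis
    using exponents_at_1 [OF le lower upper limsup liminf] by simp
qed

end
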